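(* Let $f:\mathbb{R}\to\mathbb{R}$, $x\in\mathbb{R}$, and fix one of the signs $\pm$. For all $0<\beta<1$: if the function $y\mapsto\upsilon^{\beta}_{\pm}f(y)$ is continuous at $x$, then $\upsilon^{\beta}_{\pm}f(x)=0$.
   Context: For $\epsilon>0$ put $\Delta^{+}_{\epsilon}[f](x)=f(x+\epsilon)-f(x)$ and $\Delta^{-}_{\epsilon}[f](x)=f(x)-f(x-\epsilon)$. The fractional velocity of order $\beta$ is $\upsilon^{\beta}_{\pm}f(x)=\lim_{\epsilon\to0^+}\Delta^{\pm}_{\epsilon}[f](x)/\epsilon^{\beta}$. Continuity of $\upsilon^{\beta}_{\pm}f$ at $x$ presupposes that $\upsilon^\beta_\pm f$ exists finitely at all points near $x$ (including $x$). *)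

theory Defs
  imports Complex_Main
begin

datatype side = Forward | Backward

fun difference :: "side \<Rightarrow> real \<Rightarrow> (real \<Rightarrow> real) \<Rightarrow> real \<Rightarrow> real" where
  "difference Forward \<epsilon> f x = f (x + \<epsilon>) - f x"
| "difference Backward \<epsilon> f x = f x - f (x - \<epsilon>)"

definition has_frac_velocity ::
    "side \<Rightarrow> real \<Rightarrow> (real \<Rightarrow> real) \<Rightarrow> real \<Rightarrow> real \<Rightarrow> bool" where
  "has_frac_velocity s \<beta> f x L \<longleftrightarrow>
     ((\<lambda>\<epsilon>. difference s \<epsilon> f x / \<epsilon> powr \<beta>) \<longlongrightarrow> L) (at_right 0)"

text \<open>The limit operator \<^term>\<open>Lim\<close> is total: the value below is meaningful only where a finite
  limit exists, so existence has to be assumed separately wherever it matters.\<close>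

definition frac_velocity :: "side \<Rightarrow> real \<Rightarrow> (real \<Rightarrow> real) \<Rightarrow> real \<Rightarrow> real" where
  "frac_velocity s \<beta> f x = Lim (at_right 0) (\<lambda>\<epsilon>. difference s \<epsilon> f x / \<epsilon> powr \<beta>)"

end

theory Submission
  imports Defs "HOL-Analysis.Analysis" "HOL-Real_Asymp.Real_Asymp"
begin

text \<open>If the velocity at \<open>x\<close> is positive, then by continuity it stays above some \<open>c > 0\<close> on an
  interval around \<open>x\<close>, so each \<open>y\<close> there satisfies \<open>\<Delta>\<^sub>\<epsilon> f(y) \<ge> c \<epsilon>\<^sup>\<beta>\<close> for all sufficiently small
  \<open>\<epsilon>\<close>. By the Baire category theorem the range of admissible \<open>\<epsilon>\<close> is uniform on a set \<open>E\<close> that is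
  dense in some subinterval. There \<open>f v - f u \<ge> c (v - u)\<^sup>\<beta>\<close> holds for \<open>u < v\<close> in \<open>E\<close>; summing over
  \<open>N\<close> points of \<open>E\<close> with gaps of order \<open>1/N\<close> bounds \<open>f v - f u\<close> from below by a quantity of
  order \<open>N\<^bsup>1-\<beta>\<^esup>\<close>, which is absurd. No continuity of \<open>f\<close> is involved. A negative velocity is
  treated by passing to \<open>- f\<close>.\<close>

lemma no_lower_Holder_on_dense:
  fixes f :: "real \<Rightarrow> real" and E :: "real set"
  assumes "c > 0" "0 < \<beta>" "\<beta> < 1" "u < v" "u \<in> E" "v \<in> E"
    and dense: "{u<..<v} \<subseteq> closure E"
    and incr: "\<And>y z. \<lbrakk>y \<in> E; z \<in> E; u \<le> y; y < z; z \<le> v\<rbrakk> \<Longrightarrow> c * (z - y) powr \<beta> \<le> f z - f y"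
  shows False
proof -
  have bound: "real N * (c * ((v - u) / (2 * (real N + 1))) powr \<beta>) \<le> f v - f u" for N :: nat
  proof -
    define h where "h = (v - u) / (real N + 1)"
    have "h > 0" and Nh: "(real N + 1) * h = v - u"
      using \<open>u < v\<close> by (simp_all add: h_def field_simps)
    \<comment> \<open>One point of \<open>E\<close> is taken in the left half of each of the
      \<open>N + 1\<close> cells of length \<open>h\<close>, so consecutive points are at least
      \<open>h / 2\<close> apart. Density is applied at the centre of that half, with tolerance
      \<open>h / 4\<close>.\<close>
    have "\<exists>p\<in>E. u + real i * h < p \<and> p < u + (real i + 1/2) * h" if "i \<le> N" for i
    proof -
      have "(real i + 1) * h \<le> (real N + 1) * h"
        using that \<open>h > 0\<close> by simp
      with Nh have le: "u + real i * h + h \<le> v" by (simp add: algebra_simps)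
      have "0 \<le> real i * h" using \<open>h > 0\<close> by simp
      with le \<open>h > 0\<close> have "u + real i * h + h / 4 \<in> {u<..<v}"
        unfolding greaterThanLessThan_iff by linarith
      then have "u + real i * h + h / 4 \<in> closure E" using dense by blast
      then obtain p where "p \<in> E" "dist p (u + real i * h + h / 4) < h / 4"
        using \<open>h > 0\<close> closure_approachable[of _ E]
        by (metis divide_pos_pos zero_less_numeral)
      moreover from this(2) have "u + real i * h < p \<and> p < u + (real i * h + h / 2)"
        unfolding dist_real_def by linarith
      ultimately show ?thesis
        by (intro bexI[of _ p]) (simp_all add: algebra_simps)
    qed
    then obtain p where pE: "\<And>i. i \<le> N \<Longrightarrow> p i \<in> E"
      and p1: "\<And>i. i \<le> N \<Longrightarrow> u + real i * h < p i"
      and p2: "\<And>i. i \<le> N \<Longrightarrow> p i < u + (real i + 1/2) * h"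
      by metis
    have pu: "u < p i" if "i \<le> N" for i
      using p1[OF that] \<open>h > 0\<close> by (smt (verit) mult_nonneg_nonneg of_nat_0_le_iff)
    have pv: "p i < v" if "i \<le> N" for i
    proof -
      have "(real i + 1/2) * h \<le> (real N + 1) * h"
        using that \<open>h > 0\<close> by simp
      with p2[OF that] Nh show ?thesis by simp
    qed
    have pos: "0 \<le> c * t powr \<beta>" for t using \<open>c > 0\<close> by simp
    \<comment> \<open>The increments telescope along the chosen points; the one from
      \<open>u\<close> to \<open>p 0\<close> is only used as nonnegative.\<close>
    have step: "f u + real i * (c * (h / 2) powr \<beta>) \<le> f (p i)" if "i \<le> N" for i
      using that
    proof (induction i)
      case 0
      show ?case
        using incr[of u "p 0"] pu[of 0] pv[of 0] pE[of 0] \<open>u \<in> E\<close> pos[of "p 0 - u"] by simp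
    next
      case (Suc i)
      have gap: "h / 2 \<le> p (Suc i) - p i"
        using p1[of "Suc i"] p2[of i] Suc.prems by (simp add: algebra_simps)
      have "c * (h / 2) powr \<beta> \<le> c * (p (Suc i) - p i) powr \<beta>"
        using gap \<open>h > 0\<close> \<open>c > 0\<close> \<open>0 < \<beta>\<close> by (intro mult_left_mono powr_mono2) auto
      also have "\<dots> \<le> f (p (Suc i)) - f (p i)"
        using gap \<open>h > 0\<close> Suc.prems pE[of i] pE[of "Suc i"] pu[of i] pv[of "Suc i"]
        by (intro incr) auto
      finally show ?case using Suc by (simp add: algebra_simps)
    qed
    have "f (p N) \<le> f v"
      using incr[of "p N" v] pu[of N] pv[of N] pE[of N] \<open>v \<in> E\<close> pos[of "v - p N"] by simp
    with step[of N] show ?thesis by (simp add: h_def mult.commute)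
  qed
  define C where "C = v - u"
  have "C > 0" using \<open>u < v\<close> by (simp add: C_def)
  \<comment> \<open>The expression grows like \<open>N powr (1 - \<beta>)\<close>; this is where
    \<beta> < 1 enters.\<close>
  then have "filterlim (\<lambda>N::nat. real N * (c * (C / (2 * (real N + 1))) powr \<beta>)) at_top sequentially"
    using assms(1-3) by real_asymp
  then obtain N :: nat where "f v - f u < real N * (c * (C / (2 * (real N + 1))) powr \<beta>)"
    by (metis (mono_tags, lifting) eventually_sequentially filterlim_at_top_dense order_refl)
  with bound[of N] show False by (simp add: C_def)
qed

text \<open>Otherwise the complements of the closures are open and dense, so their intersection is
  dense, yet it misses the interval. Passing to closures allows arbitrary \<open>A n\<close>, at the
  price of yielding only density of some \<open>A n\<close> in a ball.\<close>

lemma Baire_interval_cover: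
  fixes A :: "nat \<Rightarrow> real set"
  assumes "a < b" and cover: "{a<..<b} \<subseteq> (\<Union>n. A n)"
  obtains n where "interior (closure (A n)) \<noteq> {}"
proof -
  have False if empty: "\<And>n. interior (closure (A n)) = {}"
  proof -
    have "UNIV \<subseteq> closure (\<Inter>n. - closure (A n))"
    proof (rule Baire)
      fix T assume "T \<in> range (\<lambda>n. - closure (A n))"
      then show "openin (top_of_set UNIV) T \<and> UNIV \<subseteq> closure T"
        using empty by (auto simp: closure_complement)
    qed auto
    moreover have "{a<..<b} \<inter> (\<Inter>n. - closure (A n)) = {}"
      using cover closure_subset by blast
    then have "{a<..<b} \<inter> closure (\<Inter>n. - closure (A n)) = {}"
      by (simp add: open_Int_closure_eq_empty)
    moreover have "(a + b) / 2 \<in> {a<..<b}" using \<open>a < b\<close> by simp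
    ultimately show False by blast
  qed
  then show thesis using that by blast
qed

lemma no_lower_Holder_differences:
  fixes f :: "real \<Rightarrow> real"
  assumes "c > 0" "0 < \<beta>" "\<beta> < 1" "a < b"
    and ev: "\<And>y. y \<in> {a<..<b} \<Longrightarrow> \<forall>\<^sub>F \<epsilon> in at_right 0. c * \<epsilon> powr \<beta> \<le> difference s \<epsilon> f y"
  shows False
proof -
  define A where
    "A n = {y. \<forall>\<epsilon>. 0 < \<epsilon> \<and> \<epsilon> < 1 / real (Suc n) \<longrightarrow> c * \<epsilon> powr \<beta> \<le> difference s \<epsilon> f y}" for n
  have "{a<..<b} \<subseteq> (\<Union>n. A n)"
  proof
    fix y assume "y \<in> {a<..<b}"
    from ev[OF this] obtain d where "d > 0"
      and d: "\<And>\<epsilon>. \<lbrakk>0 < \<epsilon>; \<epsilon> < d\<rbrakk> \<Longrightarrow> c * \<epsilon> powr \<beta> \<le> difference s \<epsilon> f y"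
      by (auto simp: eventually_at_right_field)
    obtain n where "1 / real (Suc n) < d"
      using \<open>d > 0\<close> by (metis nat_approx_posE)
    with d have "y \<in> A n" unfolding A_def by auto
    then show "y \<in> (\<Union>n. A n)" by blast
  qed
  with \<open>a < b\<close> obtain n where "interior (closure (A n)) \<noteq> {}"
    by (rule Baire_interval_cover)
  then obtain w r where "r > 0" and r: "ball w r \<subseteq> closure (A n)"
    by (metis all_not_in_conv mem_interior)
  \<comment> \<open>With \<open>d < r\<close>, points within \<open>d\<close> of \<open>w\<close>
    stay in the ball where \<open>A n\<close> is dense; with \<open>2 * d\<close> at most the
    threshold of \<open>A n\<close>, any two points strictly between \<open>w - d\<close> and
    \<open>w + d\<close> are close enough for its inequality.\<close>
  define d where "d = min r (1 / real (Suc n)) / 2"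
  have "d > 0" "d < r" "2 * d \<le> 1 / real (Suc n)" using \<open>r > 0\<close> by (auto simp: d_def)
  have near: "\<exists>u\<in>A n. p < u \<and> u < q" if "p < q" "w - d \<le> p" "q \<le> w + d" for p q
  proof -
    have "(p + q) / 2 \<in> {p<..<q}" "(p + q) / 2 \<in> ball w r"
      using that \<open>d < r\<close> by (auto simp: dist_real_def abs_less_iff field_simps)
    then have "{p<..<q} \<inter> closure (A n) \<noteq> {}" using r by blast
    then have "{p<..<q} \<inter> A n \<noteq> {}" by (simp add: open_Int_closure_eq_empty)
    then show ?thesis by auto
  qed
  obtain u where u: "u \<in> A n" "w - d < u" "u < w"
    using near[of "w - d" w] \<open>d > 0\<close> by auto
  obtain v where v: "v \<in> A n" "w < v" "v < w + d"
    using near[of w "w + d"] \<open>d > 0\<close> by auto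
  show False
  proof (rule no_lower_Holder_on_dense[OF assms(1-3) _ u(1) v(1)])
    show "u < v" using u v by simp
    have "{u<..<v} \<subseteq> ball w r"
      using u v \<open>d < r\<close> by (auto simp: dist_real_def)
    with r show "{u<..<v} \<subseteq> closure (A n)" by blast
    fix y z assume yz: "y \<in> A n" "z \<in> A n" "u \<le> y" "y < z" "z \<le> v"
    then have "0 < z - y" "z - y < 1 / real (Suc n)"
      using u v \<open>2 * d \<le> 1 / real (Suc n)\<close> by linarith+
    \<comment> \<open>The forward difference at the left point \<open>y\<close> and the backward
      difference at the right point \<open>z\<close> both equal \<open>f z - f y\<close>, so both
      signs are settled together.\<close>
    with yz(1,2) have "c * (z - y) powr \<beta> \<le> difference s (z - y) f y"
      "c * (z - y) powr \<beta> \<le> difference s (z - y) f z"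
      unfolding A_def by blast+
    then show "c * (z - y) powr \<beta> \<le> f z - f y" by (cases s) simp_all
  qed
qed

lemma has_frac_velocity_imp_frac_velocity:
  "has_frac_velocity s \<beta> f y L \<Longrightarrow> frac_velocity s \<beta> f y = L"
  unfolding has_frac_velocity_def frac_velocity_def
  by (intro tendsto_Lim) auto

lemma has_frac_velocity_uminus:
  assumes "has_frac_velocity s \<beta> f y L"
  shows "has_frac_velocity s \<beta> (\<lambda>t. - f t) y (- L)"
proof -
  have "difference s \<epsilon> (\<lambda>t. - f t) y = - difference s \<epsilon> f y" for \<epsilon>
    by (cases s) simp_all
  then show ?thesis
    using tendsto_minus[OF assms[unfolded has_frac_velocity_def]]
    by (simp add: has_frac_velocity_def)
qed

text \<open>A limit strictly above \<open>c\<close> forces the quotients above \<open>c\<close> for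
  small increments. A single \<open>c\<close> serves all nearby points, as the covering argument
  requires.\<close>

lemma not_eventually_frac_velocity_gt:
  fixes f :: "real \<Rightarrow> real"
  assumes "c > 0" "0 < \<beta>" "\<beta> < 1"
  shows "\<not> (\<forall>\<^sub>F y in nhds x. \<exists>L>c. has_frac_velocity s \<beta> f y L)"
proof
  assume "\<forall>\<^sub>F y in nhds x. \<exists>L>c. has_frac_velocity s \<beta> f y L"
  then obtain d where "d > 0"
    and d: "\<And>y. dist y x < d \<Longrightarrow> \<exists>L>c. has_frac_velocity s \<beta> f y L"
    by (auto simp: eventually_nhds_metric)
  show False
  proof (rule no_lower_Holder_differences[OF assms, of "x - d" "x + d" s f])
    fix y assume "y \<in> {x - d<..<x + d}"
    then have "dist y x < d" by (auto simp: dist_real_def)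
    then obtain L where "L > c" "has_frac_velocity s \<beta> f y L" using d by blast
    then have "\<forall>\<^sub>F \<epsilon> in at_right 0. c < difference s \<epsilon> f y / \<epsilon> powr \<beta>"
      unfolding has_frac_velocity_def by (intro order_tendstoD)
    with eventually_at_right_less[of 0]
    show "\<forall>\<^sub>F \<epsilon> in at_right 0. c * \<epsilon> powr \<beta> \<le> difference s \<epsilon> f y"
      by eventually_elim (simp add: pos_less_divide_eq)
  qed (use \<open>d > 0\<close> in simp)
qed

theorem theorem3:
  fixes f :: "real \<Rightarrow> real" and x \<beta> :: real and s :: side
  assumes "0 < \<beta>" and "\<beta> < 1"
    and "\<forall>\<^sub>F y in nhds x. \<exists>L. has_frac_velocity s \<beta> f y L"
    and "isCont (frac_velocity s \<beta> f) x"
  shows "frac_velocity s \<beta> f x = 0"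
proof (rule ccontr)
  let ?v = "frac_velocity s \<beta> f"
  \<comment> \<open>Continuity is put over the full neighbourhood filter, \<open>x\<close> included,
    to combine with the existence assumption.\<close>
  have lim: "(?v \<longlongrightarrow> ?v x) (nhds x)"
    using assms(4) by (simp add: continuous_at tendsto_at_iff_tendsto_nhds)
  have ex: "\<forall>\<^sub>F y in nhds x. has_frac_velocity s \<beta> f y (?v y)"
    using assms(3) by eventually_elim (auto simp: has_frac_velocity_imp_frac_velocity)
  assume "?v x \<noteq> 0"
  then consider "?v x > 0" | "?v x < 0" by linarith
  then show False
  proof cases
    case 1
    \<comment> \<open>Half the value at \<open>x\<close> is the uniform positive bound.\<close>
    then have "\<forall>\<^sub>F y in nhds x. ?v x / 2 < ?v y"
      by (intro order_tendstoD(1)[OF lim]) simp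
    with ex have "\<forall>\<^sub>F y in nhds x. \<exists>L > ?v x / 2. has_frac_velocity s \<beta> f y L"
      by eventually_elim blast
    with 1 assms(1,2) show False
      using not_eventually_frac_velocity_gt[of "?v x / 2"] by simp
  next
    case 2
    then have "\<forall>\<^sub>F y in nhds x. ?v y < ?v x / 2"
      by (intro order_tendstoD(2)[OF lim]) simp
    with ex have "\<forall>\<^sub>F y in nhds x. \<exists>L > - ?v x / 2. has_frac_velocity s \<beta> (\<lambda>t. - f t) y L"
    proof eventually_elim
      case (elim y)
      then show ?case
        using has_frac_velocity_uminus[OF elim(1)] by (intro exI[of _ "- ?v y"]) simp
    qed
    with 2 assms(1,2) show False
      using not_eventually_frac_velocity_gt[of "- ?v x / 2"] by simp
  qed
qed

end
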